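(* Let $m \ge 5$ be odd and $n = 3^m-1$. Then the ternary cyclic code $\mathcal{C}_{(0,3,m)}$ has parameters $[n,k,d]$ with $d \ge \frac{3^{(m-1)/2}+7}{2}$ if $m \equiv 3 \pmod 4$ and $d \ge \frac{3^{(m-1)/2}+5}{2}$ if $m \equiv 1 \pmod 4$, and $k = \frac{n}{2}$ if $m \equiv 3 \pmod 4$ and $k = \frac{n+2}{2}$ if $m \equiv 1 \pmod 4$.
   Context: Let $m \ge 2$ be an integer, $n = 3^m-1$, and let $\alpha$ be a primitive element of $\mathbb{F}_{3^m}$. For an integer $0 \le j \le n-1$ with $3$-adic expansion $j = \sum_{t=0}^{m-1} j_t 3^t$, $j_t \in \{0,1,2\}$, let $w_3(j) = \sum_{t=0}^{m-1} j_t$. For distinct $i_1, i_2 \in \{0,1,2,3\}$ let $T_{(i_1,i_2,m)} = \{1 \le j \le n-1 : w_3(j) \equiv i_1 \text{ or } i_2 \pmod 4\}$ and $g_{(i_1,i_2,m)}(x) = \prod_{j \in T_{(i_1,i_2,m)}} (x - \alpha^j) \in \mathbb{F}_3[x]$. $\mathcal{C}_{(i_1,i_2,m)}$ denotes the ternary cyclic code of length $n$ with generator polynomial $g_{(i_1,i_2,m)}(x)$. Parameters $[n,k,d]$ mean length, dimension over $\mathbb{F}_3$, and minimum Hamming distance. *)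

theory Defs
  imports "HOL-Computational_Algebra.Polynomial"
begin

definition w3 :: "nat \<Rightarrow> nat \<Rightarrow> nat" where
  "w3 m j = (\<Sum>t<m. (j div 3 ^ t) mod 3)"

definition T_set :: "nat \<Rightarrow> nat \<Rightarrow> nat \<Rightarrow> nat set" where
  "T_set i1 i2 m = {j. 1 \<le> j \<and> j \<le> 3 ^ m - 2 \<and>
        (w3 m j mod 4 = i1 \<or> w3 m j mod 4 = i2)}"

definition primitive_elem :: "'a::{field,finite} \<Rightarrow> bool" where
  "primitive_elem \<alpha> \<longleftrightarrow> \<alpha> \<noteq> 0 \<and> (\<forall>j. 1 \<le> j \<and> j < card (UNIV :: 'a set) - 1 \<longrightarrow> \<alpha> ^ j \<noteq> 1)"

definition gen_poly :: "nat \<Rightarrow> nat \<Rightarrow> nat \<Rightarrow> 'a::field \<Rightarrow> 'a poly" where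
  "gen_poly i1 i2 m \<alpha> = (\<Prod>j\<in>T_set i1 i2 m. [:- (\<alpha> ^ j), 1:])"

text \<open>Ternary polynomials, i.e. polynomials over the prime field F_3 inside 'a.\<close>
definition ternary_poly :: "'a::field poly \<Rightarrow> bool" where
  "ternary_poly c \<longleftrightarrow> (\<forall>i. coeff c i \<in> range (of_int :: int \<Rightarrow> 'a))"

text \<open>The cyclic code of length n = 3^m - 1 generated by g: codewords c(x) of degree < n
  over F_3 that are multiples of g modulo x^n - 1 (equivalently, since g divides x^n - 1,
  the multiples of g of degree < n).\<close>
definition cyc_code :: "nat \<Rightarrow> nat \<Rightarrow> nat \<Rightarrow> 'a::{field,finite} \<Rightarrow> 'a poly set" where
  "cyc_code i1 i2 m \<alpha> = {c. ternary_poly c \<and> (c = 0 \<or> degree c < 3 ^ m - 1) \<and>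
       (\<exists>a. ternary_poly a \<and> c = (a * gen_poly i1 i2 m \<alpha>) mod (monom 1 (3 ^ m - 1) - 1))}"

definition hweight :: "'a::zero poly \<Rightarrow> nat" where
  "hweight c = card {i. coeff c i \<noteq> 0}"

definition min_dist :: "'a::zero poly set \<Rightarrow> nat" where
  "min_dist C = Min (hweight ` (C - {0}))"

end

theory Submission
  imports Defs
begin

text \<open>
  Write \<open>m = 2h + 1\<close>. For \<open>1 \<le> i \<le> 3\<^sup>e\<close> the digits of \<open>i (3\<^sup>e - 1)\<close> are those of \<open>i - 1\<close> followed by
  their complement, so \<open>i (3\<^sup>e - 1) + b 3\<^sup>2\<^sup>h\<close> has digit sum \<open>2e + b\<close> as long as no carry occurs. With
  \<open>e \<in> {h, h + 1}\<close> and a suitable digit \<open>b\<close> this gives long arithmetic progressions of even zeros and of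
  odd zeros of the code. Since the step \<open>3\<^sup>e - 1\<close> has greatest common divisor 2 with \<open>n\<close>, the BCH bound is applied
  separately to the images of a codeword modulo \<open>x\<^sup>N - 1\<close> (even zeros) and modulo \<open>x\<^sup>N + 1\<close> (odd zeros),
  \<open>N = n / 2\<close>; a codeword that vanishes modulo \<open>x\<^sup>N - 1\<close> has twice the weight of its other image.

  For the dimension, the 4-periodic sign \<open>\<epsilon>\<close> with values \<open>1, -1, -1, 1\<close> satisfies
  \<open>\<epsilon>(w) + \<epsilon>(w + 1) + \<epsilon>(w + 2) = \<epsilon>(w + 1)\<close>, so the sum of \<open>\<epsilon>\<close> of the digit sum over
  all \<open>m\<close>-digit numbers is \<open>\<epsilon>(m)\<close>.
\<close>

section \<open>Ternary digit sums\<close>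

lemma w3_0 [simp]: "w3 0 j = 0"
  by (simp add: w3_def)

lemma w3_Suc: "w3 (Suc m) j = j mod 3 + w3 m (j div 3)"
proof -
  have "w3 (Suc m) j = (\<Sum>t\<in>{..<Suc m}. (j div 3 ^ t) mod 3)"
    by (simp add: w3_def)
  also have "\<dots> = j mod 3 + (\<Sum>t<m. (j div 3 ^ Suc t) mod 3)"
    by (subst sum.lessThan_Suc_shift) simp
  finally show ?thesis
    by (simp add: w3_def div_mult2_eq)
qed

lemma w3_zero [simp]: "w3 m 0 = 0"
  by (simp add: w3_def)

text \<open>The low \<open>k\<close> digits of \<open>a * 3 ^ k + b\<close> are those of
  \<open>b\<close>, the rest those of \<open>a\<close>. The induction strips the lowest
  digit.\<close>

lemma w3_append:
  assumes "b < 3 ^ k"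
  shows "w3 (k + l) (a * 3 ^ k + b) = w3 k b + w3 l a"
  using assms
proof (induction k arbitrary: b)
  case (Suc k)
  have *: "(a * 3 ^ Suc k + b) mod 3 = b mod 3"
    "(a * 3 ^ Suc k + b) div 3 = a * 3 ^ k + b div 3"
    by (simp_all add: mod_add_eq [symmetric] algebra_simps)
  have "b div 3 < 3 ^ k"
    using Suc.prems by (simp add: less_mult_imp_div_less mult.commute)
  then show ?case
    using Suc.IH [of "b div 3"] by (simp add: w3_Suc * del: power_Suc)
qed simp

text \<open>All \<open>k\<close> digits of \<open>3 ^ k - 1\<close> are 2, so the subtraction never
  borrows and replaces each digit \<open>d\<close> by \<open>2 - d\<close>.\<close>

lemma w3_complement:
  assumes "b < 3 ^ k"
  shows "w3 k (3 ^ k - 1 - b) + w3 k b = 2 * k"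
  using assms
proof (induction k arbitrary: b)
  case (Suc k)
  have lt: "b div 3 < 3 ^ k"
    using Suc.prems by (simp add: less_mult_imp_div_less mult.commute)
  obtain q r where b: "b = 3 * q + r" "r < 3"
    by (metis mult_div_mod_eq mod_less_divisor zero_less_numeral)
  have qr: "b div 3 = q" "b mod 3 = r"
    using b by simp_all
  obtain p where p: "3 ^ k = q + Suc p"
    using lt unfolding qr by (metis add_Suc_right less_imp_Suc_add)
  have eq: "3 ^ Suc k - 1 - b = (2 - r) + 3 * p" "3 ^ k - 1 - q = p"
    using b by (simp_all add: p)
  have "(3 ^ Suc k - 1 - b) mod 3 = 2 - r" "(3 ^ Suc k - 1 - b) div 3 = 3 ^ k - 1 - q"
    unfolding eq by (simp_all only: mod_mult_self2 div_mult_self2) simp_all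
  then have "w3 (Suc k) (3 ^ Suc k - 1 - b) = (2 - r) + w3 k (3 ^ k - 1 - q)"
    by (simp only: w3_Suc)
  moreover have "w3 (Suc k) b = r + w3 k q"
    by (simp only: w3_Suc qr)
  ultimately show ?case
    using Suc.IH [OF lt] b(2) unfolding qr by simp
qed simp

lemma w3_full: "w3 k (3 ^ k - 1) = 2 * k"
  using w3_complement [of 0 k] by simp

lemma w3_top_digit:
  assumes "i < 3 ^ k" "b < 3"
  shows "w3 (Suc k) (b * 3 ^ k + i) = w3 k i + b"
  using w3_append [OF assms(1), of 1 b] assms(2) by (simp add: w3_Suc)

lemma w3_extend:
  assumes "i < 3 ^ k" "k \<le> e"
  shows "w3 e i = w3 k i"
  using w3_append [OF assms(1), of "e - k" 0] assms(2) by simp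

lemma w3_progression:
  fixes e k i b :: nat
  assumes "i < 3 ^ k" "k \<le> e" "b < 3"
  defines "j \<equiv> (3 ^ e - 1) * Suc i + b * 3 ^ (e + k)"
  shows "w3 (Suc (e + k)) j = 2 * e + b" "j < 3 ^ Suc (e + k)"
proof -
  have ie: "i < 3 ^ e"
    using assms(1,2) by (meson le_less_trans less_le_trans one_le_numeral order_le_less power_increasing)
  obtain q where q: "3 ^ e = i + Suc q"
    using ie by (metis add_Suc_right less_imp_Suc_add)
  \<comment> \<open>From the bottom: \<open>e\<close> digits complementary to those of
    \<open>i\<close>, then \<open>k\<close> digits of \<open>i\<close>, then \<open>b\<close>. The
    first two blocks together contribute \<open>2 * e\<close>.\<close>
  have j: "j = (b * 3 ^ k + i) * 3 ^ e + (3 ^ e - 1 - i)"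
    unfolding j_def power_add by (simp add: q algebra_simps)
  have "w3 (e + Suc k) j = w3 e (3 ^ e - 1 - i) + w3 (Suc k) (b * 3 ^ k + i)"
    unfolding j using ie by (intro w3_append) auto
  then show "w3 (Suc (e + k)) j = 2 * e + b"
    using w3_complement [OF ie] w3_extend [OF assms(1,2)] w3_top_digit [OF assms(1,3)] by simp
  have "b * 3 ^ k + i + 1 \<le> 3 ^ Suc k"
  proof -
    have "b * 3 ^ k \<le> 2 * 3 ^ k"
      using assms(3) by (intro mult_right_mono) auto
    then show ?thesis
      using assms(1) by (simp only: power_Suc)
  qed
  then have "(b * 3 ^ k + i + 1) * 3 ^ e \<le> 3 ^ Suc k * 3 ^ e"
    by (rule mult_right_mono) simp
  then show "j < 3 ^ Suc (e + k)"
    unfolding j using q by (simp add: power_add algebra_simps)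
qed

lemma progression_in_T_set:
  fixes e k i b m :: nat
  assumes "i < 3 ^ k" "k \<le> e" "b < 3" "0 < k" "m = Suc (e + k)"
    and "(2 * e + b) mod 4 = i1 \<or> (2 * e + b) mod 4 = i2"
  shows "(3 ^ e - 1) * Suc i + b * 3 ^ (e + k) \<in> T_set i1 i2 m"
proof -
  let ?j = "(3 ^ e - 1) * Suc i + b * 3 ^ (e + k)"
  note w = w3_progression [OF assms(1-3)]
  have "?j \<noteq> 0"
  proof
    assume "?j = 0"
    then have "2 * e + b = 0"
      using w(1) by (simp only: w3_zero)
    then show False
      using assms(2,4) by simp
  qed
  \<comment> \<open>The digit sum of \<open>3 ^ m - 1\<close> is \<open>2 * (e + k + 1)\<close>,
    which exceeds \<open>2 * e + 2\<close> because \<open>0 < k\<close>.\<close>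
  moreover have "?j \<noteq> 3 ^ m - 1"
    using w(1) w3_full [of m] assms(3-5) by auto
  ultimately have "1 \<le> ?j" "?j \<le> 3 ^ m - 2"
    using w(2) unfolding assms(5) by linarith+
  then show ?thesis
    using w(1) assms(5,6) by (simp only: T_set_def mem_Collect_eq)
qed

section \<open>The size of the defining set\<close>

definition quarter_sign :: "nat \<Rightarrow> int" where
  "quarter_sign w = (if w mod 4 = 0 \<or> w mod 4 = 3 then 1 else - 1)"

text \<open>The outer terms cancel, since a shift by 2 flips the sign.\<close>

lemma quarter_sign_sum3:
  "quarter_sign w + quarter_sign (Suc w) + quarter_sign (Suc (Suc w)) = quarter_sign (Suc w)"
proof -
  have "w mod 4 < 4" by simp
  then have "w mod 4 = 0 \<or> w mod 4 = 1 \<or> w mod 4 = 2 \<or> w mod 4 = 3" by linarith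
  then show ?thesis
    by (auto simp: quarter_sign_def mod_Suc)
qed

text \<open>Summing over the lowest digit turns the shift \<open>s\<close> into
  \<open>Suc s\<close>, so the induction needs an arbitrary shift.\<close>

lemma sum_quarter_sign_w3: "(\<Sum>j<3 ^ m. quarter_sign (w3 m j + s)) = quarter_sign (m + s)"
proof (induction m arbitrary: s)
  case (Suc m)
  have split: "(\<Sum>j<3 * K. f j) = (\<Sum>j<K. f (3 * j) + f (3 * j + 1) + f (3 * j + 2))"
    for f :: "nat \<Rightarrow> int" and K
  proof (induction K)
    case (Suc K)
    have "3 * Suc K = Suc (Suc (Suc (3 * K)))" by simp
    then show ?case
      using Suc.IH by (simp only: sum.lessThan_Suc) (simp add: add_ac)
  qed simp
  have w: "w3 (Suc m) (3 * j) = w3 m j" "w3 (Suc m) (3 * j + 1) = Suc (w3 m j)"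
    "w3 (Suc m) (3 * j + 2) = Suc (Suc (w3 m j))" for j
  proof -
    have "(3 * j + 1) div 3 = j" "(3 * j + 1) mod 3 = 1" "(3 * j + 2) div 3 = j" "(3 * j + 2) mod 3 = 2"
      by presburger+
    then show "w3 (Suc m) (3 * j) = w3 m j" "w3 (Suc m) (3 * j + 1) = Suc (w3 m j)"
      "w3 (Suc m) (3 * j + 2) = Suc (Suc (w3 m j))"
      by (simp_all only: w3_Suc) simp_all
  qed
  have "(\<Sum>j<3 ^ Suc m. quarter_sign (w3 (Suc m) j + s)) = (\<Sum>j<3 ^ m. quarter_sign (w3 m j + Suc s))"
    unfolding power_Suc split w using quarter_sign_sum3 by (intro sum.cong) auto
  then show ?case
    using Suc.IH [of "Suc s"] by simp
qed simp

lemma finite_T_set: "finite (T_set i1 i2 m)"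
  by (rule finite_subset [of _ "{..3 ^ m - 2}"]) (auto simp: T_set_def)

lemma card_T_set_0_3:
  assumes "odd m"
  shows "2 * int (card (T_set 0 3 m)) = 3 ^ m + quarter_sign m - 2"
proof -
  define A where "A = {j \<in> {..<3 ^ m}. w3 m j mod 4 = 0 \<or> w3 m j mod 4 = 3}"
  \<comment> \<open>Of the two exponents that \<open>T_set\<close> leaves out, 0 has digit sum 0 and
    lies in \<open>A\<close>, while \<open>3 ^ m - 1\<close> has digit sum \<open>2 * m\<close>,
    congruent to 2 modulo 4 for odd \<open>m\<close>, and does not.\<close>
  have "A = insert 0 (T_set 0 3 m)"
  proof (rule set_eqI)
    fix j
    have "w3 m (3 ^ m - 1) mod 4 = 2"
      using assms unfolding w3_full by presburger
    then have "j \<in> A \<Longrightarrow> j \<noteq> 3 ^ m - 1"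
      by (auto simp: A_def)
    then show "j \<in> A \<longleftrightarrow> j \<in> insert 0 (T_set 0 3 m)"
      by (auto simp: A_def T_set_def)
  qed
  then have cA: "card A = Suc (card (T_set 0 3 m))"
    using finite_T_set by (simp add: T_set_def card_insert_if)
  have "quarter_sign m = (\<Sum>j<3 ^ m. quarter_sign (w3 m j))"
    using sum_quarter_sign_w3 [of m 0] by simp
  also have "\<dots> = (\<Sum>j<3 ^ m. (if j \<in> A then 2 else 0) - 1)"
    by (intro sum.cong) (auto simp: quarter_sign_def A_def)
  also have "\<dots> = (\<Sum>j<3 ^ m. (if j \<in> A then 2 else 0)) - 3 ^ m"
    by (simp add: sum_subtractf)
  also have "(\<Sum>j<3 ^ m. (if j \<in> A then 2 else 0)) = (\<Sum>j\<in>A. 2 :: int)"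
  proof -
    have "{..<3 ^ m} \<inter> A = A"
      by (auto simp: A_def)
    then show ?thesis
      by (simp flip: sum.inter_restrict)
  qed
  finally show ?thesis
    by (simp add: cA)
qed

section \<open>Ternary polynomials\<close>

lemma cube_add_char3:
  fixes x y :: "'a::comm_ring_1"
  assumes "(3 :: 'a) = 0"
  shows "(x + y) ^ 3 = x ^ 3 + y ^ 3"
proof -
  have "(x + y) ^ 3 = x ^ 3 + y ^ 3 + 3 * (x * y * (x + y))"
    by (simp add: algebra_simps power3_eq_cube)
  then show ?thesis
    by (simp add: assms)
qed

text \<open>Translation by 1 permutes the field; comparing the sums of all elements before and after
  shows that the cardinality is 0 in the field.\<close>

lemma three_eq_0_field_card:
  assumes "card (UNIV :: 'a::{field,finite} set) = 3 ^ m"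
  shows "(3 :: 'a) = 0"
proof -
  have "bij_betw (\<lambda>x :: 'a. x + 1) UNIV UNIV"
    by (rule bij_betw_byWitness [where f' = "\<lambda>x. x - 1"]) auto
  then have "(\<Sum>x\<in>UNIV. x + (1 :: 'a)) = (\<Sum>x\<in>UNIV. x)"
    by (rule sum.reindex_bij_betw)
  then have "of_nat (card (UNIV :: 'a set)) = (0 :: 'a)"
    by (simp add: sum.distrib)
  then have "(3 :: 'a) ^ m = 0"
    by (simp add: assms)
  then show ?thesis
    by simp
qed

lemma prime_field_iff_cube:
  fixes x :: "'a::field"
  assumes "(3 :: 'a) = 0"
  shows "x \<in> range of_int \<longleftrightarrow> x ^ 3 = x"
proof
  assume "x \<in> range of_int"
  then obtain k where k: "x = of_int k" by auto
  have "3 dvd k \<or> 3 dvd k - 1 \<or> 3 dvd k + 1" by presburger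
  then have "3 dvd k * (k - 1) * (k + 1)"
    by (auto intro: dvd_mult dvd_mult2)
  then obtain l where "k * (k - 1) * (k + 1) = 3 * l" by auto
  then have "k ^ 3 - k = 3 * l"
    by (simp add: algebra_simps power3_eq_cube)
  then have "x ^ 3 - x = 3 * of_int l"
    unfolding k by (metis of_int_diff of_int_mult of_int_numeral of_int_power)
  then show "x ^ 3 = x"
    by (simp add: assms)
next
  assume "x ^ 3 = x"
  then have "x * ((x - 1) * (x + 1)) = 0"
    by (simp add: algebra_simps power3_eq_cube)
  then have "x = of_int 0 \<or> x = of_int 1 \<or> x = of_int (- 1)"
    by (auto simp: add_eq_0_iff2)
  then show "x \<in> range of_int"
    by blast
qed

lemma card_prime_field_char3:
  assumes "(3 :: 'a::field) = 0"
  shows "card (range (of_int :: int \<Rightarrow> 'a)) = 3"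
proof -
  have "range (of_int :: int \<Rightarrow> 'a) = {0, 1, - 1}"
  proof (rule set_eqI)
    fix x :: 'a
    have "x ^ 3 = x \<longleftrightarrow> x * ((x - 1) * (x + 1)) = 0"
      by (simp add: algebra_simps power3_eq_cube)
    then show "x \<in> range of_int \<longleftrightarrow> x \<in> {0, 1, - 1}"
      unfolding prime_field_iff_cube [OF assms] by (auto simp: add_eq_0_iff2)
  qed
  moreover have "(1 :: 'a) \<noteq> - 1"
  proof
    assume "(1 :: 'a) = - 1"
    then have "(2 :: 'a) = 0"
      by (metis add.right_inverse one_add_one)
    moreover have "(3 :: 'a) = 2 + 1" by simp
    ultimately show False using assms by simp
  qed
  ultimately show ?thesis
    by simp
qed

text \<open>In characteristic 3 cubing acts on coefficients and sends \<open>x\<close> to its cube.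
  The criterion is multiplicative, so it passes to products and exact quotients.\<close>

lemma ternary_poly_iff_cube:
  fixes p :: "'a::field poly"
  assumes "(3 :: 'a) = 0"
  shows "ternary_poly p \<longleftrightarrow> p ^ 3 = pcompose p (monom 1 3)"
proof (induction p)
  case 0
  then show ?case by (simp add: ternary_poly_def) (metis of_int_0 rangeI)
next
  case (pCons a p)
  have 3: "(3 :: 'a poly) = 0"
    by (metis assms numeral_poly pCons_0_0)
  have "pCons a p = [:a:] + monom 1 1 * p"
    by (simp add: monom_altdef)
  then have "pCons a p ^ 3 = [:a ^ 3:] + monom 1 3 * p ^ 3"
    by (simp only: cube_add_char3 [OF 3] power_mult_distrib monom_power)
       (simp add: power3_eq_cube)
  then have "pCons a p ^ 3 = pcompose (pCons a p) (monom 1 3) \<longleftrightarrow>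
      [:a ^ 3:] + monom 1 3 * p ^ 3 = [:a:] + monom 1 3 * pcompose p (monom 1 3)"
    by (simp add: pcompose_pCons)
  also have "\<dots> \<longleftrightarrow> a ^ 3 = a \<and> p ^ 3 = pcompose p (monom 1 3)"
  proof
    assume eq: "[:a ^ 3:] + monom 1 3 * p ^ 3 = [:a:] + monom 1 3 * pcompose p (monom 1 3)"
    then have "coeff ([:a ^ 3:] + monom 1 3 * p ^ 3) 0 = coeff ([:a:] + monom 1 3 * pcompose p (monom 1 3)) 0"
      by simp
    then have "a ^ 3 = a"
      by (simp add: coeff_monom_mult)
    moreover from this eq have "monom 1 3 * p ^ 3 = monom 1 3 * pcompose p (monom 1 3)"
      by simp
    ultimately show "a ^ 3 = a \<and> p ^ 3 = pcompose p (monom 1 3)"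
      by (simp add: monom_eq_0_iff)
  qed simp
  finally have "pCons a p ^ 3 = pcompose (pCons a p) (monom 1 3) \<longleftrightarrow> a ^ 3 = a \<and> ternary_poly p"
    using pCons.IH by simp
  moreover have "ternary_poly (pCons a p) \<longleftrightarrow> a \<in> range of_int \<and> ternary_poly p"
    unfolding ternary_poly_def by (auto simp: coeff_pCons split: nat.splits)
  ultimately show ?case
    using prime_field_iff_cube [OF assms] by simp
qed

lemma ternary_poly_mult:
  assumes "(3 :: 'a::field) = 0" "ternary_poly (p :: 'a poly)" "ternary_poly q"
  shows "ternary_poly (p * q)"
  using assms(2,3) by (simp add: ternary_poly_iff_cube [OF assms(1)] power_mult_distrib pcompose_mult)

lemma ternary_poly_cancel:
  assumes "(3 :: 'a::field) = 0" "ternary_poly ((p :: 'a poly) * q)" "ternary_poly q" "q \<noteq> 0"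
  shows "ternary_poly p"
proof -
  have "p ^ 3 * q ^ 3 = pcompose p (monom 1 3) * q ^ 3"
    using assms(2,3) by (simp add: ternary_poly_iff_cube [OF assms(1)] power_mult_distrib pcompose_mult)
  then show ?thesis
    using assms(4) by (simp add: ternary_poly_iff_cube [OF assms(1)])
qed

text \<open>Bounding coefficients rather than the degree treats the zero polynomial and
  \<open>k = 0\<close> uniformly; the constant coefficient is split off in the induction.\<close>

lemma card_bounded_polys:
  assumes "0 \<in> A"
  shows "card {p :: 'a::zero poly. (\<forall>i. coeff p i \<in> A) \<and> (\<forall>i\<ge>k. coeff p i = 0)} = card A ^ k"
proof (induction k)
  case 0
  have "{p :: 'a poly. (\<forall>i. coeff p i \<in> A) \<and> (\<forall>i\<ge>0. coeff p i = 0)} = {0}"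
    using assms by (auto simp: poly_eq_iff)
  then show ?case by simp
next
  case (Suc k)
  let ?P = "\<lambda>k. {p :: 'a poly. (\<forall>i. coeff p i \<in> A) \<and> (\<forall>i\<ge>k. coeff p i = 0)}"
  have "?P (Suc k) = (\<lambda>(a, p). pCons a p) ` (A \<times> ?P k)"
  proof (intro equalityI subsetI)
    fix p assume p: "p \<in> ?P (Suc k)"
    obtain a q where q: "p = pCons a q" by (rule pCons_cases)
    have "a \<in> A"
      using p q by (metis (mono_tags, lifting) coeff_pCons_0 mem_Collect_eq)
    moreover have "coeff q i \<in> A" "k \<le> i \<Longrightarrow> coeff q i = 0" for i
      using p unfolding q by (metis (mono_tags, lifting) Suc_le_mono coeff_pCons_Suc mem_Collect_eq)+
    ultimately show "p \<in> (\<lambda>(a, p). pCons a p) ` (A \<times> ?P k)"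
      using q by auto
  qed (auto simp: coeff_pCons Suc_le_eq split: nat.splits)
  moreover have "inj_on (\<lambda>(a, p). pCons a p) (A \<times> ?P k)"
    by (auto simp: inj_on_def)
  ultimately show ?case
    using Suc.IH by (simp add: card_image card_cartesian_product)
qed

section \<open>The code as a set of multiples of the generator\<close>

lemma prod_linear_factors_dvd:
  fixes p :: "'a::field poly"
  assumes "finite A" "\<And>x. x \<in> A \<Longrightarrow> poly p x = 0"
  shows "(\<Prod>x\<in>A. [:- x, 1:]) dvd p"
  using assms
proof (induction A rule: finite_induct)
  case (insert x A)
  then obtain q where q: "p = (\<Prod>x\<in>A. [:- x, 1:]) * q" by auto
  have "poly (\<Prod>x\<in>A. [:- x, 1:]) x \<noteq> 0"
    using insert.hyps by (auto simp: poly_prod)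
  then have "poly q x = 0"
    using insert.prems [of x] by (simp add: q)
  then obtain r where "q = [:- x, 1:] * r"
    by (auto simp: poly_eq_0_iff_dvd)
  then have "p = (\<Prod>x\<in>insert x A. [:- x, 1:]) * r"
    unfolding q using insert.hyps by (simp only: prod.insert [OF insert.hyps] mult_ac)
  then show ?case
    by simp
qed simp

locale primitive_char3 =
  fixes \<alpha> :: "'a::{field,finite}" and m :: nat
  assumes m_pos: "0 < m"
    and card_field: "card (UNIV :: 'a set) = 3 ^ m"
    and primitive: "primitive_elem \<alpha>"
begin

abbreviation "n \<equiv> (3 :: nat) ^ m - 1"

lemma three_eq_0: "(3 :: 'a) = 0"
  using card_field by (rule three_eq_0_field_card)

lemma \<alpha>_nonzero [simp]: "\<alpha> \<noteq> 0"
  using primitive by (simp add: primitive_elem_def)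

lemma n_pos: "0 < n"
  using m_pos one_less_power [of "3 :: nat" m] by simp

lemma n_half: "n div 2 + n div 2 = n"
proof -
  have "even n" by simp
  then show ?thesis by presburger
qed

text \<open>Multiplication by \<open>x\<close> permutes the nonzero elements, so their product is
  unchanged by the factor \<open>x ^ n\<close>.\<close>

lemma power_n: "x ^ n = 1" if "x \<noteq> 0" for x :: 'a
proof -
  have "bij_betw (\<lambda>y. x * y) (UNIV - {0}) (UNIV - {0})"
    using that by (intro bij_betw_byWitness [where f' = "\<lambda>y. y / x"]) auto
  then have "(\<Prod>y\<in>UNIV - {0}. x * y) = (\<Prod>y\<in>UNIV - {0}. y)"
    by (rule prod.reindex_bij_betw)
  then have "x ^ card (UNIV - {0 :: 'a}) * (\<Prod>y\<in>UNIV - {0}. y) = (\<Prod>y\<in>UNIV - {0}. y)"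
    by (simp add: prod.distrib)
  moreover have "(\<Prod>y\<in>UNIV - {0 :: 'a}. y) \<noteq> 0"
    by simp
  ultimately show ?thesis
    by (simp add: card_Diff_singleton card_field)
qed

lemma \<alpha>_power_ne_1: "0 < j \<Longrightarrow> j < n \<Longrightarrow> \<alpha> ^ j \<noteq> 1"
  using primitive card_field by (auto simp: primitive_elem_def)

lemma inj_on_\<alpha>_power: "inj_on (\<lambda>j. \<alpha> ^ j) {..<n}"
proof (rule linorder_inj_onI)
  fix i j assume "i < j" "i \<in> {..<n}" "j \<in> {..<n}"
  then have "\<alpha> ^ j = \<alpha> ^ i * \<alpha> ^ (j - i)" "\<alpha> ^ (j - i) \<noteq> 1"
    using \<alpha>_power_ne_1 [of "j - i"] by (simp_all flip: power_add)
  then show "\<alpha> ^ i \<noteq> \<alpha> ^ j"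
    by auto
qed auto

lemma T_set_subset: "T_set i1 i2 m \<subseteq> {..<n}"
  using m_pos n_pos by (auto simp: T_set_def)

lemma gen_poly_eq_prod_image: "gen_poly i1 i2 m \<alpha> = (\<Prod>x\<in>(\<lambda>j. \<alpha> ^ j) ` T_set i1 i2 m. [:- x, 1:])"
  unfolding gen_poly_def
  by (subst prod.reindex) (use inj_on_\<alpha>_power T_set_subset in \<open>auto intro: inj_on_subset\<close>)

lemma gen_poly_nonzero: "gen_poly i1 i2 m \<alpha> \<noteq> 0"
  by (simp add: gen_poly_def finite_T_set)

lemma degree_gen_poly: "degree (gen_poly i1 i2 m \<alpha>) = card (T_set i1 i2 m)"
  unfolding gen_poly_def by (subst degree_prod_eq_sum_degree) auto

lemma poly_gen_poly: "j \<in> T_set i1 i2 m \<Longrightarrow> poly (gen_poly i1 i2 m \<alpha>) (\<alpha> ^ j) = 0"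
  by (auto simp: gen_poly_def poly_prod finite_T_set)

lemma gen_poly_dvd_iff:
  "gen_poly i1 i2 m \<alpha> dvd c \<longleftrightarrow> (\<forall>j\<in>T_set i1 i2 m. poly c (\<alpha> ^ j) = 0)"
proof
  assume "gen_poly i1 i2 m \<alpha> dvd c"
  then show "\<forall>j\<in>T_set i1 i2 m. poly c (\<alpha> ^ j) = 0"
    by (auto simp: poly_gen_poly)
next
  assume "\<forall>j\<in>T_set i1 i2 m. poly c (\<alpha> ^ j) = 0"
  then show "gen_poly i1 i2 m \<alpha> dvd c"
    unfolding gen_poly_eq_prod_image by (intro prod_linear_factors_dvd) (auto simp: finite_T_set)
qed

text \<open>Multiplication by 3 modulo \<open>3 ^ m - 1\<close> rotates the ternary digits, so it permutes the
  defining set; hence \<open>g(x)\<^sup>3 = g(x\<^sup>3)\<close>.\<close>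

lemma ternary_gen_poly: "ternary_poly (gen_poly i1 i2 m \<alpha>)"
proof -
  obtain l where l: "m = Suc l"
    using m_pos gr0_implies_Suc by blast
  \<comment> \<open>\<open>\<sigma>\<close> moves the top digit to the bottom: it is tripling modulo
    \<open>n\<close>, except that \<open>n\<close> is sent to itself and not to 0.\<close>
  define \<sigma> where "\<sigma> j = 3 * (j mod 3 ^ l) + j div 3 ^ l" for j :: nat
  have dig: "j div 3 ^ l < 3" if "j < 3 ^ m" for j :: nat
    using that l by (simp add: less_mult_imp_div_less)
  have dm: "j = (j div 3 ^ l) * 3 ^ l + j mod 3 ^ l" for j :: nat
    by (simp only: div_mult_mod_eq)
  have \<sigma>_div: "\<sigma> j div 3 = j mod 3 ^ l" "\<sigma> j mod 3 = j div 3 ^ l" if "j < 3 ^ m" for j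
    using dig [OF that] by (simp_all add: \<sigma>_def)
  have inj: "inj_on \<sigma> {..<3 ^ m}"
    by (rule inj_onI) (metis \<sigma>_div dm lessThan_iff)
  have T_lt: "T_set i1 i2 m \<subseteq> {..<3 ^ m}"
    using T_set_subset by fastforce
  have w: "w3 m (\<sigma> j) = w3 m j" if "j < 3 ^ m" for j
  proof -
    have "w3 m j = w3 l (j mod 3 ^ l) + j div 3 ^ l"
      using w3_top_digit [of "j mod 3 ^ l" l "j div 3 ^ l"] dig [OF that] l
      by (simp only: flip: dm) simp
    then show ?thesis
      using \<sigma>_div [OF that] by (simp add: l w3_Suc)
  qed
  have lt: "\<sigma> j < 3 ^ m" if "j < 3 ^ m" for j
  proof -
    have "j mod 3 ^ l < 3 ^ l" by simp
    then have "\<sigma> j < 3 * 3 ^ l"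
      unfolding \<sigma>_def using dig [OF that] by linarith
    then show ?thesis by (simp add: l)
  qed
  have \<sigma>0: "\<sigma> 0 = 0" by (simp add: \<sigma>_def)
  have \<sigma>n: "\<sigma> n = n"
  proof -
    obtain p :: nat where p: "3 ^ l = Suc p"
      using gr0_implies_Suc [of "3 ^ l"] by auto
    have n_eq: "n = p + Suc p * 2"
      by (simp add: l p)
    have "n mod 3 ^ l = p"
      unfolding n_eq p by (simp only: mod_mult_self2) simp
    moreover have "n div 3 ^ l = 2"
      unfolding n_eq p by (intro div_nat_eqI) simp_all
    ultimately show ?thesis
      unfolding \<sigma>_def by (simp only: n_eq) simp
  qed
  \<comment> \<open>Both excluded exponents 0 and \<open>n\<close> are fixed by the injective map
    \<open>\<sigma>\<close>, so no other exponent is sent to them.\<close>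
  have "\<sigma> ` T_set i1 i2 m \<subseteq> T_set i1 i2 m"
  proof
    fix y assume "y \<in> \<sigma> ` T_set i1 i2 m"
    then obtain j where j: "j \<in> T_set i1 i2 m" "y = \<sigma> j" by auto
    have jm: "j < 3 ^ m" using j T_lt by auto
    have "j \<noteq> 0" "j \<noteq> n"
      using j(1) n_pos by (auto simp: T_set_def)
    then have "\<sigma> j \<noteq> 0" "\<sigma> j \<noteq> n"
      using inj_onD [OF inj, of j 0] inj_onD [OF inj, of j n] jm \<sigma>0 \<sigma>n by auto
    then show "y \<in> T_set i1 i2 m"
      using j lt [OF jm] w [OF jm] by (auto simp: T_set_def)
  qed
  then have bij: "bij_betw \<sigma> (T_set i1 i2 m) (T_set i1 i2 m)"
    using inj_on_subset [OF inj T_lt] finite_T_set by (simp add: bij_betw_def endo_inj_surj)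
  have \<alpha>\<sigma>: "\<alpha> ^ \<sigma> j = (\<alpha> ^ j) ^ 3" for j
  proof -
    have "j * 3 = \<sigma> j + n * (j div 3 ^ l)"
    proof -
      have "\<sigma> j + n * (j div 3 ^ l) = 3 * (j mod 3 ^ l) + (1 + n) * (j div 3 ^ l)"
        by (simp only: \<sigma>_def add_mult_distrib mult_1 add.assoc)
      also have "\<dots> = 3 * ((j div 3 ^ l) * 3 ^ l + j mod 3 ^ l)"
        by (simp add: l)
      finally show ?thesis
        by (simp only: div_mult_mod_eq mult.commute [of j])
    qed
    then have "(\<alpha> ^ j) ^ 3 = \<alpha> ^ \<sigma> j * (\<alpha> ^ n) ^ (j div 3 ^ l)"
      by (simp only: flip: power_mult power_add)
    then show ?thesis
      using power_n [OF \<alpha>_nonzero] by (simp only: power_one mult_1_right)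
  qed
  have 3: "(3 :: 'a poly) = 0"
    by (metis three_eq_0 numeral_poly pCons_0_0)
  have "[:- (\<alpha> ^ j), 1:] ^ 3 = pcompose [:- (\<alpha> ^ \<sigma> j), 1:] (monom 1 3)" for j
  proof -
    have "[:- (\<alpha> ^ j), 1:] = [:- (\<alpha> ^ j):] + monom 1 1"
      by (simp add: monom_altdef)
    then have "[:- (\<alpha> ^ j), 1:] ^ 3 = [:- (\<alpha> ^ j):] ^ 3 + monom 1 3"
      by (simp only: cube_add_char3 [OF 3] monom_power) simp
    then show ?thesis
      by (simp add: \<alpha>\<sigma> pcompose_pCons power3_eq_cube)
  qed
  then have "gen_poly i1 i2 m \<alpha> ^ 3
      = (\<Prod>j\<in>T_set i1 i2 m. pcompose [:- (\<alpha> ^ \<sigma> j), 1:] (monom 1 3))"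
    by (simp only: gen_poly_def prod_power_distrib)
  also have "\<dots> = (\<Prod>j\<in>T_set i1 i2 m. pcompose [:- (\<alpha> ^ j), 1:] (monom 1 3))"
    using bij by (rule prod.reindex_bij_betw)
  also have "\<dots> = pcompose (gen_poly i1 i2 m \<alpha>) (monom 1 3)"
    by (simp add: gen_poly_def pcompose_prod)
  finally show ?thesis
    by (simp add: ternary_poly_iff_cube [OF three_eq_0])
qed

text \<open>Reduction modulo \<open>monom 1 n - 1\<close> does not change values at
  \<open>n\<close>-th roots of unity.\<close>

lemma cyc_code_root:
  assumes "c \<in> cyc_code i1 i2 m \<alpha>" "j \<in> T_set i1 i2 m"
  shows "poly c (\<alpha> ^ j) = 0"
proof -
  obtain a where c: "c = (a * gen_poly i1 i2 m \<alpha>) mod (monom 1 n - 1)"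
    using assms(1) by (auto simp: cyc_code_def)
  have "poly (monom 1 n - 1) (\<alpha> ^ j) = 0"
    using power_n [of "\<alpha> ^ j"] by (simp add: poly_monom)
  then show ?thesis
    unfolding c by (simp add: poly_mod poly_gen_poly [OF assms(2)])
qed

lemma degree_monom_minus_1: "degree (monom 1 n - 1 :: 'a poly) = n"
  using n_pos degree_add_eq_left [of "- 1" "monom (1 :: 'a) n"] by (simp add: degree_monom_eq)

text \<open>A codeword vanishes at all roots of the generator, so the generator divides it exactly,
  with a ternary cofactor of bounded degree. This parametrization is injective and makes the code
  countable by cofactors.\<close>

lemma cyc_code_eq_image:
  "cyc_code i1 i2 m \<alpha> = (\<lambda>a. a * gen_poly i1 i2 m \<alpha>) `
     {a. (\<forall>i. coeff a i \<in> range of_int) \<and> (\<forall>i\<ge>n - card (T_set i1 i2 m). coeff a i = 0)}"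
  (is "_ = ?f ` ?P")
proof (intro equalityI subsetI)
  let ?g = "gen_poly i1 i2 m \<alpha>"
  fix c assume c: "c \<in> cyc_code i1 i2 m \<alpha>"
  then have "?g dvd c"
    using cyc_code_root gen_poly_dvd_iff by blast
  then obtain a where a: "c = a * ?g"
    by (metis dvd_def mult.commute)
  have "ternary_poly c" "c = 0 \<or> degree c < n"
    using c by (auto simp: cyc_code_def)
  then have "ternary_poly a" "a = 0 \<or> degree a + card (T_set i1 i2 m) < n"
    using ternary_poly_cancel [OF three_eq_0 _ ternary_gen_poly gen_poly_nonzero]
      gen_poly_nonzero [of i1 i2] degree_mult_eq [of a ?g]
    unfolding a by (force simp: degree_gen_poly)+
  then show "c \<in> ?f ` ?P"
    unfolding a by (intro imageI) (auto simp: ternary_poly_def intro: coeff_eq_0)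
next
  let ?g = "gen_poly i1 i2 m \<alpha>"
  fix c assume "c \<in> ?f ` ?P"
  then obtain a where a: "a \<in> ?P" "c = a * ?g" by auto
  have ta: "ternary_poly a"
    using a(1) by (simp add: ternary_poly_def)
  have deg: "degree c < n" if "c \<noteq> 0"
  proof -
    have "a \<noteq> 0" using that a(2) by auto
    then have "\<not> n - card (T_set i1 i2 m) \<le> degree a"
      using a(1) leading_coeff_0_iff by blast
    then show ?thesis
      using \<open>a \<noteq> 0\<close> gen_poly_nonzero [of i1 i2] a(2) by (simp add: degree_mult_eq degree_gen_poly)
  qed
  \<comment> \<open>The degree is below \<open>n\<close>, so the reduction in
    \<open>cyc_code\<close> is trivial and \<open>a\<close> itself is a witness.\<close>
  have "c = c mod (monom 1 n - 1)"
    using deg degree_monom_minus_1 by (cases "c = 0") (auto simp: mod_poly_less)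
  then show "c \<in> cyc_code i1 i2 m \<alpha>"
    using deg ternary_poly_mult [OF three_eq_0 ta ternary_gen_poly] ta a(2)
    unfolding cyc_code_def by auto
qed

lemma card_cyc_code: "card (cyc_code i1 i2 m \<alpha>) = 3 ^ (n - card (T_set i1 i2 m))"
proof -
  have "(0 :: 'a) \<in> range of_int"
    by (metis of_int_0 rangeI)
  moreover have "inj_on (\<lambda>a. a * gen_poly i1 i2 m \<alpha>) X" for X
    using gen_poly_nonzero [of i1 i2] by (auto simp: inj_on_def)
  ultimately show ?thesis
    unfolding cyc_code_eq_image
    by (simp add: card_image card_bounded_polys card_prime_field_char3 [OF three_eq_0])
qed


section \<open>The half power of a primitive element and the common divisor of
  \<open>3 ^ e - 1\<close> with \<open>n\<close>\<close>

lemma \<alpha>_half_power: "\<alpha> ^ (n div 2) = - 1"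
proof -
  have "\<alpha> ^ (n div 2) * \<alpha> ^ (n div 2) = 1"
    using power_n [of \<alpha>] n_half by (metis \<alpha>_nonzero power_add)
  moreover have "\<alpha> ^ (n div 2) \<noteq> 1"
    using n_half n_pos by (intro \<alpha>_power_ne_1) linarith+
  ultimately show ?thesis
    by (simp add: square_eq_1_iff)
qed

text \<open>Although \<open>3 ^ e - 1\<close> is not invertible modulo \<open>n\<close>, the common divisor with \<open>n\<close> is only 2:
  an element fixed by the \<open>e\<close>-th and the \<open>m\<close>-th power of the Frobenius map is fixed by the map itself.\<close>

lemma inj_on_\<alpha>_power_step:
  assumes "2 * e + 1 = m \<or> 2 * e = m + 1"
  shows "inj_on (\<lambda>s. (\<alpha> ^ (3 ^ e - 1)) ^ s) {..<n div 2}"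
proof (rule linorder_inj_onI)
  fix s t assume st: "s < t" "s \<in> {..<n div 2}" "t \<in> {..<n div 2}"
  define y where "y = \<alpha> ^ (t - s)"
  have y0: "y \<noteq> 0"
    by (simp add: y_def)
  have ym: "y ^ 3 ^ m = y"
  proof -
    have "y ^ 3 ^ m = y ^ Suc n" by simp
    then show ?thesis
      using power_n [OF y0] by (simp only: power_Suc mult_1_right)
  qed
  show "(\<alpha> ^ (3 ^ e - 1)) ^ s \<noteq> (\<alpha> ^ (3 ^ e - 1)) ^ t"
  proof
    assume eq: "(\<alpha> ^ (3 ^ e - 1)) ^ s = (\<alpha> ^ (3 ^ e - 1)) ^ t"
    have "(\<alpha> ^ (3 ^ e - 1)) ^ t = (\<alpha> ^ (3 ^ e - 1)) ^ s * (\<alpha> ^ (3 ^ e - 1)) ^ (t - s)"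
      using st(1) by (simp flip: power_add)
    then have "(\<alpha> ^ (3 ^ e - 1)) ^ (t - s) = 1"
      using eq by auto
    then have "y ^ (3 ^ e - 1) = 1"
      by (simp add: y_def mult.commute flip: power_mult)
    moreover have "y ^ 3 ^ e = y ^ Suc (3 ^ e - 1)"
      by simp
    ultimately have ye: "y ^ 3 ^ e = y"
      by (simp only: power_Suc mult_1_right)
    then have ye2: "y ^ 3 ^ (2 * e) = y"
      by (metis mult_2 power_add power_mult)
    \<comment> \<open>The exponents \<open>2 * e\<close> and \<open>m\<close> differ by exactly 1,
      so the two Frobenius powers fixing \<open>y\<close> differ by one application.\<close>
    have "y ^ 3 = y"
      using assms
    proof
      assume "2 * e + 1 = m"
      then have "y ^ 3 ^ m = (y ^ 3 ^ (2 * e)) ^ 3"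
        by (auto simp: mult.commute simp flip: power_mult)
      then show ?thesis
        using ym ye2 by simp
    next
      assume "2 * e = m + 1"
      then have "y ^ 3 ^ (2 * e) = (y ^ 3 ^ m) ^ 3"
        by (simp add: mult.commute flip: power_mult)
      then show ?thesis
        using ym ye2 by simp
    qed
    then have "y * y ^ 2 = y * 1"
      by (simp add: power3_eq_cube power2_eq_square)
    then have "y ^ 2 = 1"
      using y0 by (simp only: mult_cancel_left) simp
    \<comment> \<open>Here the range \<open>{..<n div 2}\<close> matters: it keeps
      \<open>(t - s) * 2\<close> below the order \<open>n\<close>.\<close>
    then have "\<alpha> ^ ((t - s) * 2) = 1"
      by (simp only: y_def power_mult)
    moreover have "0 < (t - s) * 2" "(t - s) * 2 < n"
      using st by auto
    ultimately show False
      using \<alpha>_power_ne_1 by blast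
  qed
qed auto

end

section \<open>The minimum distance\<close>

text \<open>The BCH bound: the power sums vanish against every polynomial of degree less than \<open>L\<close>, in
  particular against one that vanishes at all but one of the points of the support.\<close>

lemma bch_bound:
  fixes c x :: "nat \<Rightarrow> 'a::field"
  assumes inj: "inj_on x {..<N}"
    and sums: "\<And>i. i < L \<Longrightarrow> (\<Sum>s<N. c s * x s ^ i) = 0"
    and s0: "s0 < N" "c s0 \<noteq> 0"
  shows "L < card {s. s < N \<and> c s \<noteq> 0}"
proof (rule ccontr)
  define S where "S = {s. s < N \<and> c s \<noteq> 0}"
  assume "\<not> L < card {s. s < N \<and> c s \<noteq> 0}"
  then have L: "card S \<le> L"
    by (simp add: S_def)
  have S: "finite S" "s0 \<in> S" "S \<subseteq> {..<N}"
    using s0 by (auto simp: S_def)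
  define p where "p = (\<Prod>t\<in>S - {s0}. [:- x t, 1:])"
  have "degree p = card S - 1"
    unfolding p_def by (subst degree_prod_eq_sum_degree) (use S in auto)
  moreover have "0 < card S"
    using S by (auto simp: card_gt_0_iff)
  ultimately have deg: "degree p < L"
    using L by linarith
  have "(\<Sum>s<N. c s * poly p (x s)) = (\<Sum>s<N. \<Sum>i\<le>degree p. coeff p i * (c s * x s ^ i))"
    by (simp add: poly_altdef sum_distrib_left mult_ac)
  also have "\<dots> = (\<Sum>i\<le>degree p. coeff p i * (\<Sum>s<N. c s * x s ^ i))"
    by (subst sum.swap) (simp add: sum_distrib_left)
  also have "\<dots> = 0"
    using deg sums by (intro sum.neutral) auto
  finally have "(\<Sum>s<N. c s * poly p (x s)) = 0" .
  moreover have "(\<Sum>s<N. c s * poly p (x s)) = (\<Sum>s\<in>{s0}. c s * poly p (x s))"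
  proof (rule sum.mono_neutral_right)
    show "\<forall>s\<in>{..<N} - {s0}. c s * poly p (x s) = 0"
      using S by (auto simp: p_def poly_prod S_def)
  qed (use s0 in auto)
  moreover have "poly p (x s0) \<noteq> 0"
    using S inj s0 by (auto simp: p_def poly_prod inj_on_def)
  ultimately show False
    using s0 by simp
qed

context primitive_char3
begin

lemma bch_bound_progression:
  fixes u :: "nat \<Rightarrow> 'a"
  assumes e: "2 * e + 1 = m \<or> 2 * e = m + 1"
    and zeros: "\<And>i. i < L \<Longrightarrow> (\<Sum>s<n div 2. u s * (\<alpha> ^ ((3 ^ e - 1) * Suc i + b)) ^ s) = 0"
    and s0: "s0 < n div 2" "u s0 \<noteq> 0"
  shows "L < card {s. s < n div 2 \<and> u s \<noteq> 0}"
proof -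
  \<comment> \<open>Absorbing the initial term of the progression into the coefficients makes the
    power sums start at exponent 0; the factor is nonzero, so the support is unchanged.\<close>
  let ?c = "\<lambda>s. u s * (\<alpha> ^ ((3 ^ e - 1) + b)) ^ s"
  have "L < card {s. s < n div 2 \<and> ?c s \<noteq> 0}"
  proof (rule bch_bound [OF inj_on_\<alpha>_power_step [OF e]])
    fix i assume "i < L"
    have "?c s * ((\<alpha> ^ (3 ^ e - 1)) ^ s) ^ i = u s * (\<alpha> ^ ((3 ^ e - 1) * Suc i + b)) ^ s" for s
    proof -
      have "((v + b) * s) + (v * s) * i = (v * Suc i + b) * s" for v :: nat
        by (simp add: algebra_simps)
      then show ?thesis
        by (simp only: mult.assoc flip: power_mult power_add)
    qed
    then show "(\<Sum>s<n div 2. ?c s * ((\<alpha> ^ (3 ^ e - 1)) ^ s) ^ i) = 0"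
      using zeros [OF \<open>i < L\<close>] by (simp only:)
  qed (use s0 in auto)
  then show ?thesis
    by simp
qed

text \<open>Since \<open>\<alpha> ^ (n div 2) = - 1\<close>, the upper half of the coefficients
  folds onto the lower half with sign \<open>(- 1) ^ j\<close>. Even \<open>j\<close> thus see
  \<open>c\<close> modulo \<open>x ^ N - 1\<close> and odd \<open>j\<close> see it modulo
  \<open>x ^ N + 1\<close>, where \<open>N = n div 2\<close>.\<close>

lemma poly_at_\<alpha>_power:
  assumes "degree c < n"
  shows "poly c (\<alpha> ^ j) = (\<Sum>s<n div 2. (coeff c s + (- 1) ^ j * coeff c (s + n div 2)) * (\<alpha> ^ j) ^ s)"
proof -
  define N where "N = n div 2"
  have nN: "n = N + N"
    by (simp only: N_def n_half)
  have "poly c (\<alpha> ^ j) = (\<Sum>s<n. coeff c s * (\<alpha> ^ j) ^ s)"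
    unfolding poly_altdef using assms
    by (intro sum.mono_neutral_left) (auto simp: coeff_eq_0)
  also have "\<dots> = (\<Sum>s<N. coeff c s * (\<alpha> ^ j) ^ s) + (\<Sum>s<N. coeff c (s + N) * (\<alpha> ^ j) ^ (s + N))"
  proof -
    have split: "sum f {..<N + K} = sum f {..<N} + (\<Sum>s<K. f (s + N))" for f :: "nat \<Rightarrow> 'a" and K
      by (induction K) (simp_all add: add_ac)
    show ?thesis
      unfolding nN by (rule split)
  qed
  also have "(\<lambda>s. (\<alpha> ^ j) ^ (s + N)) = (\<lambda>s. (- 1) ^ j * (\<alpha> ^ j) ^ s)"
  proof -
    have "(\<alpha> ^ j) ^ N = (\<alpha> ^ N) ^ j"
      by (simp add: mult.commute flip: power_mult)
    then show ?thesis
      using \<alpha>_half_power by (simp add: power_add N_def mult.commute)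
  qed
  finally show ?thesis
    by (simp add: N_def sum.distrib algebra_simps)
qed

text \<open>The first alternative holds if the image modulo \<open>x ^ N - 1\<close> is nonzero.
  Otherwise the upper half of \<open>c\<close> is the negative of the lower half, and the weight is
  at least \<open>2 * (L' + 1)\<close>.\<close>

lemma hweight_lower_bound:
  assumes c: "c \<in> cyc_code i1 i2 m \<alpha>" "c \<noteq> 0"
    and e: "2 * e + 1 = m \<or> 2 * e = m + 1" and e': "2 * e' + 1 = m \<or> 2 * e' = m + 1"
    and b: "even b" and b': "odd b'"
    and zeros: "\<And>i. i < L \<Longrightarrow> (3 ^ e - 1) * Suc i + b \<in> T_set i1 i2 m"
    and zeros': "\<And>i. i < L' \<Longrightarrow> (3 ^ e' - 1) * Suc i + b' \<in> T_set i1 i2 m"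
  shows "L < hweight c \<or> 2 * L' + 1 < hweight c"
proof -
  define N where "N = n div 2"
  have nN: "n = N + N"
    by (simp only: N_def n_half)
  have deg: "degree c < n"
    using c by (auto simp: cyc_code_def)
  define S where "S = {i. coeff c i \<noteq> 0}"
  have S_lt: "S \<subseteq> {..<n}"
    using deg by (auto simp: S_def intro: le_less_trans le_degree)
  have S_fin: "finite S"
    using S_lt by (rule finite_subset) simp
  show ?thesis
  proof (cases "\<exists>s0<N. coeff c s0 + coeff c (s0 + N) \<noteq> 0")
    case True
    then obtain s0 where s0: "s0 < N" "coeff c s0 + coeff c (s0 + N) \<noteq> 0" by auto
    define U where "U = {s. s < N \<and> coeff c s + coeff c (s + N) \<noteq> 0}"
    have "L < card U"
      unfolding U_def N_def
    proof (rule bch_bound_progression [OF e])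
      fix i assume "i < L"
      let ?j = "(3 ^ e - 1) * Suc i + b"
      have "poly c (\<alpha> ^ ?j) = 0"
        using c(1) zeros [OF \<open>i < L\<close>] by (rule cyc_code_root)
      \<comment> \<open>As \<open>3 ^ e - 1\<close> is even, the whole progression has the parity of
        \<open>b\<close>.\<close>
      moreover have "(- 1 :: 'a) ^ ?j = 1"
        using b by simp
      ultimately show "(\<Sum>s<n div 2. (coeff c s + coeff c (s + n div 2)) * (\<alpha> ^ ?j) ^ s) = 0"
        using poly_at_\<alpha>_power [OF deg, of ?j] by (simp only: mult_1)
    qed (use s0 in \<open>auto simp: N_def\<close>)
    \<comment> \<open>A nonzero folded coefficient needs a nonzero coefficient at \<open>s\<close>
      or \<open>s + N\<close>, so folding cannot increase the weight.\<close>
    also have "U \<subseteq> (\<lambda>s. s mod N) ` S"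
    proof
      fix s assume s: "s \<in> U"
      then have "s \<in> S \<or> s + N \<in> S" "s mod N = s" "(s + N) mod N = s"
        by (auto simp: U_def S_def)
      then show "s \<in> (\<lambda>s. s mod N) ` S"
        by (metis imageI)
    qed
    then have "card U \<le> card S"
      using S_fin by (meson card_image_le card_mono finite_imageI le_trans)
    finally show ?thesis
      by (simp add: hweight_def S_def)
  next
    case False
    then have anti: "coeff c (s + N) = - coeff c s" if "s < N" for s
      using that by (auto simp: eq_neg_iff_add_eq_0 add.commute)
    have two: "(2 :: 'a) \<noteq> 0"
    proof
      assume "(2 :: 'a) = 0"
      moreover have "(3 :: 'a) = 2 + 1" by simp
      ultimately show False using three_eq_0 by simp
    qed
    define V where "V = {s. s < N \<and> coeff c s - coeff c (s + N) \<noteq> 0}"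
    have V: "V = {s. s < N \<and> coeff c s \<noteq> 0}"
    proof -
      have "coeff c s - coeff c (s + N) = 2 * coeff c s" if "s < N" for s
        using anti [OF that] by simp
      then show ?thesis
        using two unfolding V_def by (metis (no_types, lifting) mult_eq_0_iff)
    qed
    obtain s1 where s1: "s1 \<in> S"
      using c(2) by (auto simp: S_def poly_eq_iff)
    have "\<exists>s0<N. coeff c s0 \<noteq> 0"
    proof (cases "s1 < N")
      case False
      then have "s1 - N < N" "s1 = (s1 - N) + N"
        using s1 S_lt nN by auto
      then show ?thesis
        using s1 anti [of "s1 - N"] by (auto simp: S_def)
    qed (use s1 in \<open>auto simp: S_def\<close>)
    then obtain s0 where s0: "s0 \<in> V" using V by auto
    have "L' < card V"
      unfolding V_def N_def
    proof (rule bch_bound_progression [OF e'])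
      fix i assume "i < L'"
      let ?j = "(3 ^ e' - 1) * Suc i + b'"
      have "poly c (\<alpha> ^ ?j) = 0"
        using c(1) zeros' [OF \<open>i < L'\<close>] by (rule cyc_code_root)
      moreover have "(- 1 :: 'a) ^ ?j = - 1"
        using b' by simp
      ultimately show "(\<Sum>s<n div 2. (coeff c s - coeff c (s + n div 2)) * (\<alpha> ^ ?j) ^ s) = 0"
        using poly_at_\<alpha>_power [OF deg, of ?j] by (simp only: mult_minus1 diff_conv_add_uminus)
    qed (use s0 in \<open>auto simp: V_def N_def\<close>)
    moreover have "card (V \<union> (\<lambda>s. s + N) ` V) = card V + card V"
    proof (subst card_Un_disjoint)
      show "card V + card ((\<lambda>s. s + N) ` V) = card V + card V"
        by (simp add: card_image)
    qed (auto simp: V)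
    moreover have "card (V \<union> (\<lambda>s. s + N) ` V) \<le> card S"
      using S_fin by (intro card_mono) (auto simp: V S_def anti)
    ultimately show ?thesis
      by (simp add: hweight_def S_def)
  qed
qed

text \<open>The condition on the defining set gives a nonzero codeword, so that \<open>Min\<close>
  is taken over a nonempty finite set.\<close>

lemma min_dist_lower_bound:
  assumes "card (T_set i1 i2 m) < n"
    and "\<And>c. c \<in> cyc_code i1 i2 m \<alpha> \<Longrightarrow> c \<noteq> 0 \<Longrightarrow> D \<le> hweight c"
  shows "D \<le> min_dist (cyc_code i1 i2 m \<alpha>)"
proof -
  let ?C = "cyc_code i1 i2 m \<alpha>"
  have "1 < card ?C"
    using assms(1) unfolding card_cyc_code by (intro one_less_power) auto
  then have "finite ?C" "\<not> ?C \<subseteq> {0}"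
    by (auto intro: card_ge_0_finite dest: card_mono [rotated])
  then have "finite (hweight ` (?C - {0}))" "hweight ` (?C - {0}) \<noteq> {}"
    by auto
  then show ?thesis
    using assms(2) by (auto simp: min_dist_def)
qed

end

text \<open>The dimension appears as the exponent in the number of codewords, and the distance
  bounds are doubled to avoid division.\<close>

theorem theorem3:
  fixes \<alpha> :: "'a::{field,finite}" and m :: nat
  assumes "m \<ge> 5" and "odd m" and "card (UNIV :: 'a set) = 3 ^ m" and "primitive_elem \<alpha>"
  defines "n \<equiv> 3 ^ m - 1"
  shows "(m mod 4 = 3 \<longrightarrow>
            card (cyc_code 0 3 m \<alpha>) = 3 ^ (n div 2) \<and>
            2 * min_dist (cyc_code 0 3 m \<alpha>) \<ge> 3 ^ ((m - 1) div 2) + 7)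
       \<and> (m mod 4 = 1 \<longrightarrow>
            card (cyc_code 0 3 m \<alpha>) = 3 ^ ((n + 2) div 2) \<and>
            2 * min_dist (cyc_code 0 3 m \<alpha>) \<ge> 3 ^ ((m - 1) div 2) + 5)"
proof -
  interpret primitive_char3 \<alpha> m
    using assms by unfold_locales auto
  obtain h where h: "m = 2 * h + 1"
    using assms(2) by (rule oddE)
  have h2: "2 \<le> h"
    using assms(1) h by simp
  have n_eq: "int n = 3 ^ m - 1"
    by (simp add: n_def)
  have hm: "(m - 1) div 2 = h"
    by (simp add: h)
  have h9: "(9 :: nat) \<le> 3 ^ h"
    using power_increasing [OF h2, of "3 :: nat"] by simp
  note cardT = card_T_set_0_3 [OF assms(2)]
  have "card (cyc_code 0 3 m \<alpha>) = 3 ^ (n div 2)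
      \<and> 3 ^ h + 7 \<le> 2 * min_dist (cyc_code 0 3 m \<alpha>)" if m3: "m mod 4 = 3"
  proof -
    have "2 * int (card (T_set 0 3 m)) = int n"
      using cardT m3 n_eq by (simp add: quarter_sign_def)
    then have T: "2 * card (T_set 0 3 m) = n"
      by linarith
    then have "n - card (T_set 0 3 m) = n div 2" "card (T_set 0 3 m) < n"
      using n_pos unfolding n_def by linarith+
    moreover from this(2) have "3 ^ h + 1 \<le> min_dist (cyc_code 0 3 m \<alpha>)"
    proof (intro min_dist_lower_bound)
      fix c assume c: "c \<in> cyc_code 0 3 m \<alpha>" "c \<noteq> 0"
      have "3 ^ h < hweight c \<or> 2 * 3 ^ h + 1 < hweight c"
      \<comment> \<open>Here \<open>h\<close> is odd, so top digits 2 and 1 give digit sums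
        \<open>2 * h + 2\<close> and \<open>2 * h + 1\<close>, congruent to 0 and 3 modulo 4. Both
        progressions have length \<open>3 ^ h\<close>.\<close>
      proof (rule hweight_lower_bound [OF c, of h h "2 * 3 ^ (h + h)" "1 * 3 ^ (h + h)"])
        show "(3 ^ h - 1) * Suc i + 2 * 3 ^ (h + h) \<in> T_set 0 3 m" if "i < 3 ^ h" for i
          using that h h2 m3 by (intro progression_in_T_set) (auto, presburger+)
        show "(3 ^ h - 1) * Suc i + 1 * 3 ^ (h + h) \<in> T_set 0 3 m" if "i < 3 ^ h" for i
          using that h h2 m3 by (intro progression_in_T_set) auto
      qed (use h in auto)
      then show "3 ^ h + 1 \<le> hweight c"
        by linarith
    qed (simp add: n_def)
    ultimately show ?thesis
      using card_cyc_code [of 0 3] h9 unfolding n_def by simp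
  qed
  moreover have "card (cyc_code 0 3 m \<alpha>) = 3 ^ ((n + 2) div 2)
      \<and> 3 ^ h + 5 \<le> 2 * min_dist (cyc_code 0 3 m \<alpha>)" if m1: "m mod 4 = 1"
  proof -
    obtain k where k: "h = Suc k"
      using h2 by (cases h) auto
    have "2 * int (card (T_set 0 3 m)) = int n - 2"
      using cardT m1 n_eq by (simp add: quarter_sign_def)
    then have T: "2 * card (T_set 0 3 m) + 2 = n"
      by linarith
    then have "n - card (T_set 0 3 m) = (n + 2) div 2" "card (T_set 0 3 m) < n"
      by linarith+
    moreover from this(2) have "2 * 3 ^ k + 2 \<le> min_dist (cyc_code 0 3 m \<alpha>)"
    proof (intro min_dist_lower_bound)
      fix c assume c: "c \<in> cyc_code 0 3 m \<alpha>" "c \<noteq> 0"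
      have "3 ^ h < hweight c \<or> 2 * 3 ^ k + 1 < hweight c"
      \<comment> \<open>Now \<open>h\<close> is even. Top digit 0 gives the even zeros, but
        \<open>2 * h + 1\<close> is congruent to 1 modulo 4; the odd zeros use
        \<open>e' = Suc h\<close> with digit sum \<open>2 * h + 3\<close>, at the cost of the
        shorter length \<open>3 ^ k\<close>, \<open>k = h - 1\<close>.\<close>
      proof (rule hweight_lower_bound [OF c, of h "Suc h" "0 * 3 ^ (h + h)" "1 * 3 ^ (Suc h + k)"])
        show "(3 ^ h - 1) * Suc i + 0 * 3 ^ (h + h) \<in> T_set 0 3 m" if "i < 3 ^ h" for i
          using that h h2 m1 by (intro progression_in_T_set) (auto, presburger+)
        show "(3 ^ Suc h - 1) * Suc i + 1 * 3 ^ (Suc h + k) \<in> T_set 0 3 m" if "i < 3 ^ k" for i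
          using that h h2 m1 k by (intro progression_in_T_set) (auto, presburger+)
      qed (use h in auto)
      moreover have "3 \<le> (3 :: nat) ^ k"
        using h9 k by simp
      ultimately show "2 * 3 ^ k + 2 \<le> hweight c"
        using k by auto
    qed (simp add: n_def)
    \<comment> \<open>Doubling \<open>2 * 3 ^ k + 2\<close> gives \<open>4 * 3 ^ k + 4\<close>,
      which is at least \<open>3 * 3 ^ k + 5\<close>.\<close>
    ultimately show ?thesis
      using card_cyc_code [of 0 3] h9 k unfolding n_def by auto
  qed
  ultimately show ?thesis
    unfolding hm by blast
qed

end
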